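(* Let $\varphi=(\sqrt{5}-1)/2$. Then $$\liminf_{N\to\infty}\prod_{r=1}^{N}\left|2\sin(\pi r\varphi)\right|>0.$$ *)

theory Defs
  imports Complex_Main "HOL-Library.Extended_Real" "HOL-Library.Liminf_Limsup"
begin

end

theory Submission
  imports Defs "HOL-Analysis.Convex" "HOL-Computational_Algebra.Fundamental_Theorem_Algebra"
    "HOL-Number_Theory.Fib"
begin

text \<open>
  Write \<open>G n\<close> for the Fibonacci numbers \<open>1, 1, 2, 3, 5, \<dots>\<close>, \<open>P N\<close> for the product of the
  theorem and \<open>A n = P (G n - 1)\<close>. The Zeckendorf expansion of \<open>N\<close>, largest term first, splits
  \<open>P N\<close> into blocks \<open>\<Prod>r=1..G n. \<bar>2 sin (\<pi> (r \<phi> + x))\<bar>\<close> whose shift \<open>x\<close> lies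
  between \<open>(-\<phi>) ^ (n + 2)\<close> and \<open>(-\<phi>) ^ (n + 3)\<close>. There the block is log-concave in \<open>x\<close>, so it is
  bounded below by its values at the two end points, which by reflection are
  \<open>A (n + 1) / A (n - 1)\<close> and \<open>A (n + 2) / A (n + 1)\<close>. Hence it suffices that \<open>A\<close> is
  eventually increasing.

  Log-concavity once more (with the last factor of the block removed, the values at \<open>x = 0\<close> and
  at \<open>x = (-\<phi>) ^ (n + 1)\<close> are both \<open>A n\<close>) gives
  \<open>A (n + 2) \<ge> A (n + 1) A n 2 sin (\<pi> \<phi> ^ (n + 2))\<close>, so a lower bound \<open>A n \<ge> G n / 1.68\<close> is enough.
  For this let \<open>D n \<theta> = \<Prod>r=1..G n - 1. \<bar>2 sin (\<pi> r \<theta>)\<bar>\<close>, a log-concave function of \<open>\<theta>\<close> between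
  the two preceding convergents of \<open>\<phi>\<close>, with \<open>D n = G n\<close> at the \<open>n\<close>-th convergent.
  If \<open>p / q\<close> and \<open>p' / q'\<close> are Farey neighbours, then at their mediant the products over
  \<open>r < q\<close> and \<open>r < q'\<close> multiply to \<open>(q + q') / (2 sin (\<pi> / (q + q')))\<close>. So upper bounds for one
  product are lower bounds for the other; extrapolating and interpolating by concavity
  closes this loop with room to spare.
\<close>

subsection \<open>Sine products\<close>

text \<open>The shift \<open>x\<close> absorbs the starting index of a block of consecutive factors;
  \<open>x = 0\<close> gives the product of the theorem.\<close>

definition sine_prod :: "nat \<Rightarrow> real \<Rightarrow> real \<Rightarrow> real" where
  "sine_prod N \<theta> x = (\<Prod>r=1..N. \<bar>2 * sin (pi * (real r * \<theta> + x))\<bar>)"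

lemma sine_prod_0 [simp]: "sine_prod 0 \<theta> x = 1"
  by (simp add: sine_prod_def)

lemma sine_prod_Suc:
  "sine_prod (Suc N) \<theta> x = sine_prod N \<theta> x * \<bar>2 * sin (pi * (real (Suc N) * \<theta> + x))\<bar>"
  by (simp add: sine_prod_def)

lemma sin_pi_eq_0_iff: "sin (pi * y) = 0 \<longleftrightarrow> y \<in> \<int>"
  by (auto simp: sin_zero_iff_int2 mult.commute Ints_def)

lemma abs_sin_pi_add_int:
  assumes "k \<in> \<int>"
  shows "\<bar>sin (pi * (y + k))\<bar> = \<bar>sin (pi * y)\<bar>"
proof -
  have s0: "sin (pi * k) = 0"
    using assms by (simp add: sin_pi_eq_0_iff)
  then have "(cos (pi * k))\<^sup>2 = 1"
    using sin_cos_squared_add[of "pi * k"] by simp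
  then have "\<bar>cos (pi * k)\<bar> = 1"
    by (auto simp: power2_eq_1_iff)
  moreover have "sin (pi * (y + k)) = sin (pi * y) * cos (pi * k)"
    using s0 by (simp add: distrib_left sin_add)
  ultimately show ?thesis
    by (simp add: abs_mult)
qed

lemma abs_sin_pi_eq_int:
  assumes "y - z \<in> \<int> \<or> y + z \<in> \<int>"
  shows "\<bar>sin (pi * y)\<bar> = \<bar>sin (pi * z)\<bar>"
  using assms abs_sin_pi_add_int[of "y - z" z] abs_sin_pi_add_int[of "y + z" "- z"]
  by auto

lemma sine_prod_pos:
  assumes "\<And>r. \<lbrakk>1 \<le> r; r \<le> N\<rbrakk> \<Longrightarrow> real r * \<theta> + x \<notin> \<int>"
  shows "sine_prod N \<theta> x > 0"
  unfolding sine_prod_def using assms by (intro prod_pos) (auto simp: sin_pi_eq_0_iff)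

lemma sine_prod_nonneg: "sine_prod N \<theta> x \<ge> 0"
  unfolding sine_prod_def by (intro prod_nonneg) auto

lemma sine_prod_add:
  "sine_prod (M + N) \<theta> x = sine_prod M \<theta> x * sine_prod N \<theta> (x + real M * \<theta>)"
  by (induction N) (simp_all add: sine_prod_Suc algebra_simps)

lemma sine_prod_add_int:
  assumes "k \<in> \<int>"
  shows "sine_prod N \<theta> (x + k) = sine_prod N \<theta> x"
  unfolding sine_prod_def abs_mult
  using abs_sin_pi_add_int[OF assms] by (simp flip: add.assoc)

text \<open>Replacing \<open>r\<close> by \<open>M - r\<close> turns the shifted factors into those
  with index \<open>M - N, ..., M - 1\<close> of the unshifted product, exactly the ones missing
  from the second product.\<close>

lemma sine_prod_reflect:
  assumes "N < M"
  shows "sine_prod N \<theta> (- real M * \<theta>) * sine_prod (M - N - 1) \<theta> 0 = sine_prod (M - 1) \<theta> 0"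
  using assms
proof (induction N)
  case (Suc N)
  define K where "K = M - Suc N - 1"
  have M: "M - N - 1 = Suc K" "M - Suc N - 1 = K" "real M = real N + real K + 2"
    using Suc.prems by (auto simp: K_def)
  have "\<bar>sin (pi * (real (Suc N) * \<theta> + - real M * \<theta>))\<bar> = \<bar>sin (pi * (real (Suc K) * \<theta> + 0))\<bar>"
    by (rule abs_sin_pi_eq_int) (auto simp: M(3) algebra_simps)
  then have "sine_prod (Suc N) \<theta> (- real M * \<theta>) * sine_prod K \<theta> 0
      = sine_prod N \<theta> (- real M * \<theta>) * sine_prod (Suc K) \<theta> 0"
    unfolding sine_prod_Suc by (simp add: abs_mult)
  then show ?case
    using Suc M(1,2) by simp
qed auto

section \<open>Log-concavity of sine products\<close>

text \<open>Away from the zeros of the sine, the second derivative of the logarithm of its absolute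
  value is \<open>- 1 / sin\<^sup>2\<close>.\<close>

lemma ln_abs_sin_concave:
  fixes u v t :: real
  assumes nz: "\<And>s. \<lbrakk>0 \<le> s; s \<le> 1\<rbrakk> \<Longrightarrow> sin ((1 - s) * u + s * v) \<noteq> 0"
    and t: "0 \<le> t" "t \<le> 1"
  shows "(1 - t) * ln \<bar>2 * sin u\<bar> + t * ln \<bar>2 * sin v\<bar> \<le> ln \<bar>2 * sin ((1 - t) * u + t * v)\<bar>"
proof -
  define g where "g s = (1 - s) * u + s * v" for s
  \<comment> \<open>The square stands in for the absolute value, so that differentiating needs no
    case split on the sign of the sine.\<close>
  define f where "f s = ln ((2 * sin (g s))\<^sup>2) / 2" for s
  have f: "f s = ln \<bar>2 * sin (g s)\<bar>" if "s \<in> {0..1}" for s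
  proof -
    have "sin (g s) \<noteq> 0"
      using that nz by (auto simp: g_def)
    then have "ln (\<bar>2 * sin (g s)\<bar> ^ 2) = 2 * ln \<bar>2 * sin (g s)\<bar>"
      by (subst ln_realpow) auto
    then show ?thesis
      by (simp add: f_def)
  qed
  have g': "(g has_real_derivative (v - u)) (at s)" for s
    unfolding g_def by (auto intro!: derivative_eq_intros)
  note [derivative_intros] = DERIV_chain2[OF _ g']
  have "concave_on {0..1} f"
  proof (rule f''_le0_imp_concave)
    fix s :: real assume s: "s \<in> {0..1}"
    then have [simp]: "sin (g s) \<noteq> 0"
      using nz by (auto simp: g_def)
    have pos: "0 < sin (g s) * sin (g s)"
      using zero_less_power2[of "sin (g s)"] unfolding power2_eq_square by simp
    show "(f has_real_derivative (v - u) * cos (g s) / sin (g s)) (at s)"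
      unfolding f_def
      by (auto intro!: derivative_eq_intros g' simp: power2_eq_square field_simps) (rule pos)
    have "((\<lambda>s. (v - u) * cos (g s) / sin (g s)) has_real_derivative
        ((v - u) * (- sin (g s) * (v - u)) * sin (g s) - (v - u) * cos (g s) * (cos (g s) * (v - u)))
          / (sin (g s) * sin (g s))) (at s)"
      by (rule derivative_eq_intros g' refl | simp)+
    moreover have "c * (- a * c) * a - c * b * (b * c) = - c\<^sup>2 * (a\<^sup>2 + b\<^sup>2)" for a b c :: real
      by (simp add: algebra_simps power2_eq_square)
    ultimately show "((\<lambda>s. (v - u) * cos (g s) / sin (g s)) has_real_derivative - (v - u)\<^sup>2 / (sin (g s))\<^sup>2) (at s)"
      by (simp flip: power2_eq_square)
    show "- (v - u)\<^sup>2 / (sin (g s))\<^sup>2 \<le> 0"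
      by simp
  qed auto
  then have "f ((1 - t) *\<^sub>R 0 + t *\<^sub>R 1) \<ge> (1 - t) * f 0 + t * f 1"
    using t by (intro concave_onD) auto
  then have "f t \<ge> (1 - t) * f 0 + t * f 1" by simp
  then show ?thesis
    using t by (simp add: f) (simp add: g_def)
qed

text \<open>Every argument is affine in \<open>s\<close>, so the inequalities for the single factors
  add up. Later either \<open>\<theta>\<close> moves (near a convergent) or \<open>x\<close> moves
  (at the golden ratio).\<close>

lemma sine_prod_log_concave:
  assumes nz: "\<And>r s. \<lbrakk>1 \<le> r; r \<le> N; 0 \<le> s; s \<le> 1\<rbrakk> \<Longrightarrow>
      real r * ((1 - s) * \<theta> + s * \<theta>') + ((1 - s) * x + s * x') \<notin> \<int>"
    and t: "0 \<le> t" "t \<le> 1"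
  shows "(1 - t) * ln (sine_prod N \<theta> x) + t * ln (sine_prod N \<theta>' x')
    \<le> ln (sine_prod N ((1 - t) * \<theta> + t * \<theta>') ((1 - t) * x + t * x'))"
proof -
  define u v where "u r = pi * (real r * \<theta> + x)" and "v r = pi * (real r * \<theta>' + x')" for r
  have lin: "(1 - s) * u r + s * v r
      = pi * (real r * ((1 - s) * \<theta> + s * \<theta>') + ((1 - s) * x + s * x'))" for r s
    by (simp add: u_def v_def algebra_simps)
  have nz': "sin ((1 - s) * u r + s * v r) \<noteq> 0" if "r \<in> {1..N}" "0 \<le> s" "s \<le> 1" for r s
    using nz that by (simp add: lin sin_pi_eq_0_iff)
  have ln: "ln (sine_prod N ((1 - s) * \<theta> + s * \<theta>') ((1 - s) * x + s * x'))
      = (\<Sum>r=1..N. ln \<bar>2 * sin ((1 - s) * u r + s * v r)\<bar>)" if "0 \<le> s" "s \<le> 1" for s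
    unfolding sine_prod_def lin[symmetric] using nz'[OF _ that] by (subst ln_prod) auto
  have "(1 - t) * ln (sine_prod N \<theta> x) + t * ln (sine_prod N \<theta>' x')
      = (\<Sum>r=1..N. (1 - t) * ln \<bar>2 * sin (u r)\<bar> + t * ln \<bar>2 * sin (v r)\<bar>)"
    using ln[of 0] ln[of 1] by (simp add: sum.distrib sum_distrib_left)
  also have "\<dots> \<le> (\<Sum>r=1..N. ln \<bar>2 * sin ((1 - t) * u r + t * v r)\<bar>)"
    using nz' t by (intro sum_mono ln_abs_sin_concave) auto
  finally show ?thesis
    using ln[OF t] by simp
qed

section \<open>Values at rational points and at mediants\<close>

text \<open>The roots of \<open>z ^ Q - 1\<close> are simple; cancelling \<open>z - 1\<close> leaves
  the geometric sum, whose value at 1 is \<open>Q\<close>.\<close>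

lemma prod_one_minus_roots_unity:
  assumes "Q > 0"
  shows "(\<Prod>k=1..<Q. 1 - cis (2 * pi * real k / real Q)) = of_nat Q"
proof -
  let ?c = "\<lambda>k. cis (2 * pi * real k / real Q)"
  define p :: "complex poly" where "p = monom 1 Q - 1"
  define R where "R = (\<Prod>k=1..<Q. [:- ?c k, 1:])"
  have pz: "poly p z = z ^ Q - 1" for z
    by (simp add: p_def poly_monom)
  have deg: "degree p = Q"
    using assms unfolding p_def diff_conv_add_uminus
    by (subst degree_add_eq_left) (auto simp: degree_monom_eq)
  have lc: "lead_coeff p = 1"
    unfolding deg using assms by (simp add: p_def)
  have "rsquarefree p"
    unfolding rsquarefree_roots
  proof clarify
    fix a assume a: "poly p a = 0" "poly (pderiv p) a = 0"
    then have "a ^ Q = 1" by (simp add: pz)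
    moreover have "of_nat Q * a ^ (Q - 1) = 0"
      using a by (simp add: p_def pderiv_diff pderiv_monom poly_monom)
    ultimately show False
      using assms by (auto simp: power_0_left)
  qed
  then have "(\<Prod>z|poly p z = 0. [:-z, 1:]) = p"
    using complex_poly_decompose_rsquarefree[of p] lc by simp
  moreover have "(\<Prod>z|poly p z = 0. [:-z, 1:]) = (\<Prod>k<Q. [:- ?c k, 1:])"
    using prod.reindex_bij_betw[OF Complex.bij_betw_roots_unity[OF assms], of "\<lambda>z. [:-z, 1:]"]
    by (simp add: pz)
  moreover have "{..<Q} = insert 0 {1..<Q}" using assms by auto
  ultimately have "p = [:-1, 1:] * R"
    by (simp add: R_def)
  moreover have "p = [:0, 1:] ^ Q - 1"
    by (simp add: p_def monom_altdef)
  then have "p = [:-1, 1:] * (\<Sum>i<Q. [:0, 1:] ^ i)"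
    by (simp only: power_diff_1_eq) (simp add: one_pCons)
  ultimately have "[:-1, 1:] * R = [:-1, 1:] * (\<Sum>i<Q. [:0, 1:] ^ i)"
    by metis
  then have "R = (\<Sum>i<Q. [:0, 1:] ^ i)"
    by (subst (asm) mult_cancel_left) simp
  then have "poly R 1 = of_nat Q"
    by (simp add: poly_sum)
  then show ?thesis
    by (simp add: R_def poly_prod)
qed

lemma norm_one_minus_cis: "cmod (1 - cis (2 * t)) = \<bar>2 * sin t\<bar>"
proof -
  have "(cmod (1 - cis (2 * t)))\<^sup>2 = (1 - cos (2 * t))\<^sup>2 + (sin (2 * t))\<^sup>2"
    by (simp add: cmod_power2)
  also have "\<dots> = 2 - 2 * cos (2 * t)"
    using sin_cos_squared_add[of "2 * t"] by (simp add: power2_diff)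
  also have "\<dots> = \<bar>2 * sin t\<bar>\<^sup>2"
    by (simp add: cos_double_sin)
  finally show ?thesis
    by (rule power2_eq_imp_eq) auto
qed

lemma prod_sin_roots_unity:
  assumes "Q > 0"
  shows "(\<Prod>k=1..<Q. \<bar>2 * sin (pi * (real k / real Q))\<bar>) = real Q"
proof -
  have "(\<Prod>k=1..<Q. \<bar>2 * sin (pi * (real k / real Q))\<bar>)
      = cmod (\<Prod>k=1..<Q. 1 - cis (2 * pi * real k / real Q))"
    unfolding prod_norm[symmetric] norm_one_minus_cis[symmetric] by (simp add: mult.assoc)
  also have "\<dots> = real Q"
    unfolding prod_one_minus_roots_unity[OF assms] by simp
  finally show ?thesis .
qed

text \<open>Multiplication by \<open>p\<close> permutes the nonzero residues modulo
  \<open>Q\<close>, which reduces the claim to \<open>p = 1\<close>.\<close>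

lemma sine_prod_rational:
  assumes "Q > 0" "coprime p (int Q)"
  shows "sine_prod (Q - 1) (of_int p / real Q) 0 = real Q"
proof -
  define h where "h r = nat ((int r * p) mod int Q)" for r
  have h: "int (h r) = (int r * p) mod int Q" for r
    using assms by (simp add: h_def)
  have inj: "inj_on h {1..<Q}"
  proof (rule inj_onI)
    fix r s assume rs: "r \<in> {1..<Q}" "s \<in> {1..<Q}" and "h r = h s"
    then have "(int r * p) mod int Q = (int s * p) mod int Q"
      by (metis h)
    then have "int Q dvd (int r - int s) * p"
      by (simp add: mod_eq_dvd_iff left_diff_distrib)
    then have "int Q dvd int r - int s"
      using assms(2) by (metis coprime_commute coprime_dvd_mult_left_iff)
    moreover have "\<bar>int r - int s\<bar> < int Q"
      using rs by auto
    ultimately have "int r - int s = 0"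
      using zdvd_imp_le[of "int Q" "\<bar>int r - int s\<bar>"] by fastforce
    then show "r = s" by simp
  qed
  have sub: "h ` {1..<Q} \<subseteq> {1..<Q}"
  proof clarify
    fix r assume r: "r \<in> {1..<Q}"
    have "(int r * p) mod int Q \<noteq> 0"
    proof
      assume "(int r * p) mod int Q = 0"
      then have "int Q dvd int r"
        using assms(2) by (metis coprime_commute coprime_dvd_mult_left_iff mod_0_imp_dvd)
      then show False
        using r by (auto dest: zdvd_imp_le)
    qed
    then have "h r \<noteq> 0" by (metis h of_nat_0)
    moreover have "int (h r) < int Q"
      unfolding h using assms by simp
    ultimately show "h r \<in> {1..<Q}" by auto
  qed
  have bij: "bij_betw h {1..<Q} {1..<Q}"
    using inj sub by (simp add: bij_betw_def card_image card_subset_eq)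
  have eq: "\<bar>sin (pi * (real r * (of_int p / real Q)))\<bar> = \<bar>sin (pi * (real (h r) / real Q))\<bar>" for r
  proof (rule abs_sin_pi_eq_int)
    have "real (h r) = of_int (int r * p) - of_int ((int r * p) div int Q) * real Q"
      by (metis add_diff_cancel_left' h mult.commute mult_div_mod_eq of_int_diff of_int_mult of_int_of_nat_eq)
    then have "real r * (of_int p / real Q) - real (h r) / real Q = of_int ((int r * p) div int Q)"
      using assms by (simp add: field_simps)
    then show "real r * (of_int p / real Q) - real (h r) / real Q \<in> \<int> \<or>
        real r * (of_int p / real Q) + real (h r) / real Q \<in> \<int>"
      by simp
  qed
  have "{1..Q - 1} = {1..<Q}" using assms by auto
  then have "sine_prod (Q - 1) (of_int p / real Q) 0 = (\<Prod>r=1..<Q. \<bar>2 * sin (pi * (real (h r) / real Q))\<bar>)"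
    unfolding sine_prod_def abs_mult by (simp only: eq add_0_right)
  also have "\<dots> = (\<Prod>r=1..<Q. \<bar>2 * sin (pi * (real r / real Q))\<bar>)"
    by (rule prod.reindex_bij_betw[OF bij])
  finally show ?thesis
    using prod_sin_roots_unity[OF assms(1)] by simp
qed

text \<open>Since \<open>(q + q') * \<theta>\<close> is an integer, reflection at
  \<open>q + q'\<close> makes the products over \<open>r \<le> q\<close> and \<open>r < q'\<close>
  multiply to the full product \<open>q + q'\<close>. By the determinant condition the extra
  argument \<open>q * \<theta>\<close> has distance \<open>1 / (q + q')\<close> from an
  integer.\<close>

lemma sine_prod_mediant:
  fixes p p' :: int and q q' :: nat
  assumes det: "\<bar>p * int q' - p' * int q\<bar> = 1" and q: "q > 0" "q' > 0"
  defines "\<theta> \<equiv> of_int (p + p') / real (q + q')"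
  shows "sine_prod (q - 1) \<theta> 0 * sine_prod (q' - 1) \<theta> 0 * (2 * sin (pi / real (q + q'))) = real (q + q')"
proof -
  define d where "d = p * int q' - p' * int q"
  have d: "d = 1 \<or> d = -1"
    using det by (auto simp: d_def)
  have "coprime (p + p') (int (q + q'))"
  proof (rule coprimeI)
    fix c assume c: "c dvd p + p'" "c dvd int (q + q')"
    have "(p + p') * int q' - p' * int (q + q') = d"
      by (simp add: d_def algebra_simps)
    then have "c dvd d"
      using c by (metis dvd_diff dvd_mult dvd_mult2)
    then show "is_unit c" using d by auto
  qed
  then have full: "sine_prod (q + q' - 1) \<theta> 0 = real (q + q')"
    unfolding \<theta>_def using q by (intro sine_prod_rational) auto
  have Q\<theta>: "real (q + q') * \<theta> = of_int (p + p')"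
    using q by (simp add: \<theta>_def)
  have per: "sine_prod N \<theta> (- real (q + q') * \<theta>) = sine_prod N \<theta> 0" for N
    using sine_prod_add_int[of "- of_int (p + p')" N \<theta> 0] unfolding mult_minus_left Q\<theta> by simp
  have "sine_prod q \<theta> 0 * sine_prod (q' - 1) \<theta> 0 = real (q + q')"
    using sine_prod_reflect[of q "q + q'" \<theta>] q per full by simp
  moreover have "sine_prod q \<theta> 0 = sine_prod (q - 1) \<theta> 0 * \<bar>2 * sin (pi * (real q * \<theta>))\<bar>"
    using sine_prod_Suc[of "q - 1" \<theta> 0] q by simp
  moreover have "\<bar>sin (pi * (real q * \<theta>))\<bar> = \<bar>sin (pi * (1 / real (q + q')))\<bar>"
  proof (rule abs_sin_pi_eq_int)
    have "real q * of_int (p + p') + of_int d = of_int p * real (q + q')"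
      by (simp add: d_def algebra_simps)
    moreover have "real (q + q') \<noteq> 0"
      using q by simp
    ultimately have "real q * \<theta> + of_int d / real (q + q') = of_int p"
      unfolding \<theta>_def times_divide_eq_right add_divide_distrib[symmetric]
      by (metis nonzero_mult_div_cancel_right)
    then have "real q * \<theta> + of_int d / real (q + q') \<in> \<int>" by simp
    then show "real q * \<theta> - 1 / real (q + q') \<in> \<int> \<or> real q * \<theta> + 1 / real (q + q') \<in> \<int>"
      using d by auto
  qed
  moreover have "sin (pi / real (q + q')) \<ge> 0"
    using q by (intro sin_ge_zero) (auto simp: divide_le_eq)
  ultimately show ?thesis
    by (simp add: abs_mult algebra_simps)
qed

subsection \<open>Sine products near the convergents\<close>

text \<open>The index is shifted so that \<open>G n\<close> is the denominator of the convergent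
  \<open>fib n / G n\<close>.\<close>

abbreviation G :: "nat \<Rightarrow> real" where "G n \<equiv> real (fib (Suc n))"

lemma fib_Cassini_real: "G (Suc n) * real (fib n) = (G n)\<^sup>2 - (-1) ^ n"
proof -
  have "real_of_int (int (fib (Suc (Suc n)) * fib n) - int ((fib (Suc n))\<^sup>2)) = real_of_int (- ((-1) ^ n))"
    by (simp only: fib_Cassini_int)
  then show ?thesis by simp
qed

text \<open>Coordinates of \<open>(r, j)\<close> in the basis \<open>(G n, fib n)\<close>,
  \<open>(G (Suc n), G n)\<close>, whose determinant is a unit by Cassini's identity; integer
  vectors therefore have integer coordinates.\<close>

lemma fib_basis:
  fixes r j :: real
  shows "r = G n * ((-1) ^ Suc n * (j * G (Suc n) - r * G n))
      + G (Suc n) * ((-1) ^ n * (j * G n - r * real (fib n)))"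
    and "j = real (fib n) * ((-1) ^ Suc n * (j * G (Suc n) - r * G n))
      + G n * ((-1) ^ n * (j * G n - r * real (fib n)))"
proof -
  have *: "(-1) ^ n * ((G n)\<^sup>2 - G (Suc n) * real (fib n)) = (1 :: real)"
    by (simp only: fib_Cassini_real) (simp flip: power_mult_distrib)
  have "G n * ((-1) ^ Suc n * (j * G (Suc n) - r * G n))
      + G (Suc n) * ((-1) ^ n * (j * G n - r * real (fib n)))
     = r * ((-1) ^ n * ((G n)\<^sup>2 - G (Suc n) * real (fib n)))"
    by (simp add: algebra_simps power2_eq_square del: fib.simps)
  then show "r = G n * ((-1) ^ Suc n * (j * G (Suc n) - r * G n))
      + G (Suc n) * ((-1) ^ n * (j * G n - r * real (fib n)))"
    using * by simp
  have "real (fib n) * ((-1) ^ Suc n * (j * G (Suc n) - r * G n))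
      + G n * ((-1) ^ n * (j * G n - r * real (fib n)))
      = j * ((-1) ^ n * ((G n)\<^sup>2 - G (Suc n) * real (fib n)))"
    by (simp add: algebra_simps power2_eq_square del: fib.simps)
  then show "j = real (fib n) * ((-1) ^ Suc n * (j * G (Suc n) - r * G n))
      + G n * ((-1) ^ n * (j * G n - r * real (fib n)))"
    using * by simp
qed

lemma G_pos: "G n > 0"
  by (simp add: fib_neq_0_nat)

lemma G_rec: "G (Suc (Suc n)) = G (Suc n) + G n"
  by simp

text \<open>
  \<open>z = (-1) ^ n * (\<theta> * G n - fib n)\<close> is a coordinate around the convergent \<open>fib n / G n\<close> in which the
  limit \<open>\<phi>\<close> of the convergents lies on the positive side for both parities of \<open>n\<close>.
\<close>

definition fib_point :: "nat \<Rightarrow> real \<Rightarrow> real" where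
  "fib_point n z = (real (fib n) + (-1) ^ n * z) / G n"

text \<open>The bounds on \<open>z\<close> place the point strictly between convergents
  \<open>n\<close> and \<open>n + 1\<close>. If \<open>r\<close> times it were an integer
  \<open>j\<close>, both coordinates of \<open>(r, j)\<close> would be positive integers, forcing
  \<open>r \<ge> G n + G (Suc n) = G (n + 2)\<close>.\<close>

lemma fib_point_not_int:
  assumes r: "1 \<le> r" "r < fib (Suc (n + 2))" and z: "-1 < z * G n" "z * G (Suc n) < 1"
  shows "real r * fib_point (n + 2) z \<notin> \<int>"
proof
  assume "real r * fib_point (n + 2) z \<in> \<int>"
  then obtain j :: int where j: "of_int j = real r * fib_point (n + 2) z"
    by (elim Ints_cases) metis
  define X Y where "X = (-1) ^ Suc n * (j * int (fib (Suc (Suc n))) - int r * int (fib (Suc n)))"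
    and "Y = (-1) ^ n * (j * int (fib (Suc n)) - int r * int (fib n))"
  have X: "of_int X = (-1) ^ Suc n * (of_int j * G (Suc n) - real r * G n)"
    and Y: "of_int Y = (-1) ^ n * (of_int j * G n - real r * real (fib n))"
    by (simp_all add: X_def Y_def)
  have *: "(-1) ^ n * (-1) ^ n = (1 :: real)" by (simp flip: power_mult_distrib)
  have Gn: "G (Suc (Suc n)) > 0" by (rule G_pos)
  have jG: "of_int j * G (Suc (Suc n)) = real r * (G (Suc n) + (-1) ^ n * z)"
    using Gn by (simp add: j fib_point_def del: fib.simps)
  have C: "(G n)\<^sup>2 - (-1) ^ n = G (Suc n) * real (fib n)"
    "(G (Suc n))\<^sup>2 + (-1) ^ n = G (Suc (Suc n)) * G n"
    using fib_Cassini_real[of n] fib_Cassini_real[of "Suc n"] by simp_all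
  have "of_int X * G (Suc (Suc n)) = real r * (1 - z * G (Suc n))"
  proof -
    have "of_int X * G (Suc (Suc n))
        = (-1) ^ Suc n * ((of_int j * G (Suc (Suc n))) * G (Suc n) - real r * (G (Suc (Suc n)) * G n))"
      by (simp add: X algebra_simps del: fib.simps)
    also have "\<dots> = real r * (((-1) ^ n * (-1) ^ n) * (1 - z * G (Suc n)))"
      unfolding jG C(2)[symmetric] by (simp add: algebra_simps power2_eq_square del: fib.simps)
    finally show ?thesis by (simp add: * del: fib.simps)
  qed
  then have "of_int X > (0 :: real)"
    using Gn r z by (metis diff_gt_0_iff_gt mult_pos_pos of_nat_0_less_iff order_less_le_trans zero_less_mult_pos2 zero_less_one)
  have "of_int Y * G (Suc (Suc n)) = real r * (1 + z * G n)"
  proof -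
    have "of_int Y * G (Suc (Suc n))
        = (-1) ^ n * ((of_int j * G (Suc (Suc n))) * G n - real r * (G (Suc n) * real (fib n) + G n * real (fib n)))"
      by (simp add: Y algebra_simps)
    also have "\<dots> = (-1) ^ n * (real r * (G (Suc n) + (-1) ^ n * z) * G n - real r * ((G n)\<^sup>2 - (-1) ^ n + G n * real (fib n)))"
      unfolding jG C(1) ..
    also have "\<dots> = real r * (((-1) ^ n * (-1) ^ n) * (1 + z * G n))
        + (-1) ^ n * real r * G n * (G (Suc n) - G n - real (fib n))"
      by (simp add: algebra_simps power2_eq_square del: fib.simps)
    finally show ?thesis by (simp add: *)
  qed
  then have "of_int Y > (0 :: real)"
    using Gn r z by (smt (verit, best) mult_pos_pos of_nat_0_less_iff zero_less_mult_pos2 zero_less_one le_less_trans less_le_trans)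
  have "G n * 1 + G (Suc n) * 1 \<le> G n * of_int X + G (Suc n) * of_int Y"
    using \<open>of_int X > 0\<close> \<open>of_int Y > 0\<close> by (intro add_mono mult_left_mono) auto
  also have "\<dots> = real r"
    unfolding X Y using fib_basis(1)[of "real r" n "of_int j"] by simp
  finally show False using r by simp
qed

text \<open>The function \<open>D n\<close> of the overview, in the coordinate
  \<open>z\<close>.\<close>

definition fib_prod :: "nat \<Rightarrow> real \<Rightarrow> real" where
  "fib_prod n z = sine_prod (fib (Suc n) - 1) (fib_point n z) 0"

lemma fib_prod_pos:
  assumes "-1 < z * G n" "z * G (Suc n) < 1"
  shows "fib_prod (n + 2) z > 0"
  unfolding fib_prod_def using fib_point_not_int[OF _ _ assms]
  by (intro sine_prod_pos) (auto simp del: fib.simps)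

lemma fib_prod_log_concave:
  assumes a: "-1 < a * G n" "a * G (Suc n) < 1" and b: "-1 < b * G n" "b * G (Suc n) < 1"
    and t: "0 \<le> t" "t \<le> 1"
  shows "(1 - t) * ln (fib_prod (n + 2) a) + t * ln (fib_prod (n + 2) b)
    \<le> ln (fib_prod (n + 2) ((1 - t) * a + t * b))"
proof -
  have lin: "(1 - s) * fib_point (n + 2) a + s * fib_point (n + 2) b
      = fib_point (n + 2) ((1 - s) * a + s * b)" for s
    using G_pos[of "n + 2"] by (simp add: fib_point_def field_simps del: fib.simps)
  have conv: "-1 < ((1 - s) * a + s * b) * G n \<and> ((1 - s) * a + s * b) * G (Suc n) < 1"
    if s: "0 \<le> s" "s \<le> 1" for s
    using convex_bound_lt[of "- (a * G n)" 1 "- (b * G n)" "1 - s" s]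
      convex_bound_lt[of "a * G (Suc n)" 1 "b * G (Suc n)" "1 - s" s] a b s
    by (simp add: algebra_simps del: fib.simps)
  show ?thesis
    using sine_prod_log_concave[of "fib (Suc (n + 2)) - 1" "fib_point (n + 2) a"
        "fib_point (n + 2) b" 0 0 t] fib_point_not_int conv t
    unfolding lin fib_prod_def by (auto simp del: fib.simps)
qed

lemma fib_prod_0: "fib_prod n 0 = G n"
  using sine_prod_rational[of "fib (Suc n)" "int (fib n)"] coprime_fib_Suc_nat[of n]
  by (simp add: fib_prod_def fib_point_def fib_neq_0_nat)

lemma fib_point_Suc: "fib_point (Suc n) 0 = fib_point n (1 / G (Suc n))"
  using fib_Cassini_real[of n] G_pos[of n] G_pos[of "Suc n"]
  by (simp add: fib_point_def field_simps power2_eq_square del: fib.simps)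

text \<open>Convergents \<open>n\<close> and \<open>n + 2\<close> are Farey neighbours; their
  mediant is located here from either side.\<close>

lemma fib_point_mediant:
  "fib_point n (1 / (G n + G (n + 2))) = (real (fib n) + real (fib (n + 2))) / (G n + G (n + 2))"
  "fib_point (n + 2) (- 1 / (G n + G (n + 2))) = (real (fib n) + real (fib (n + 2))) / (G n + G (n + 2))"
proof -
  have C: "(-1) ^ n = (G n)\<^sup>2 - G (Suc n) * real (fib n)"
    using fib_Cassini_real[of n] by simp
  define Q where "Q = G n + G (n + 2)"
  have r: "G (n + 2) = 2 * G n + real (fib n)" "real (fib (n + 2)) = G n + real (fib n)" by simp_all
  have pos: "G n > 0" "G (n + 2) > 0" "Q > 0"
    using G_pos[of n] G_pos[of "n + 2"] by (auto simp: Q_def)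
  have "real (fib n) * Q + (-1) ^ n = (real (fib n) + real (fib (n + 2))) * G n"
    unfolding C Q_def r by (simp add: algebra_simps power2_eq_square)
  then show "fib_point n (1 / (G n + G (n + 2))) = (real (fib n) + real (fib (n + 2))) / (G n + G (n + 2))"
    using pos unfolding fib_point_def Q_def[symmetric] by (simp add: field_simps del: fib.simps)
  have "real (fib (n + 2)) * Q - (-1) ^ n = (real (fib n) + real (fib (n + 2))) * G (n + 2)"
    unfolding C Q_def r by (simp add: algebra_simps power2_eq_square)
  then show "fib_point (n + 2) (- 1 / (G n + G (n + 2))) = (real (fib n) + real (fib (n + 2))) / (G n + G (n + 2))"
    using pos unfolding fib_point_def Q_def[symmetric] power_add by (simp add: field_simps del: fib.simps)
qed

text \<open>The mediant of convergents \<open>n\<close> and \<open>n + 1\<close> is convergent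
  \<open>n + 2\<close>, which has coordinate \<open>1 / G (n + 2)\<close> around both.\<close>

lemma fib_prod_adjacent:
  "fib_prod (Suc n) (1 / G (n + 2)) * fib_prod n (1 / G (n + 2)) * (2 * sin (pi / G (n + 2))) = G (n + 2)"
proof -
  have p: "fib_point (Suc n) (1 / G (n + 2)) = fib_point (n + 2) 0"
    using fib_point_Suc[of "Suc n"] by simp
  have p': "fib_point n (1 / G (n + 2)) = fib_point (n + 2) 0"
  proof -
    have "real (fib n) * G (n + 2) + (-1) ^ n = real (fib (n + 2)) * G n"
      using fib_Cassini_real[of n] by (simp add: algebra_simps power2_eq_square)
    then show ?thesis
      using G_pos[of n] G_pos[of "n + 2"]
      by (simp add: fib_point_def field_simps del: fib.simps)
  qed
  have det: "int (fib (Suc n)) * int (fib (Suc n)) - int (fib n) * int (fib (Suc (Suc n))) = (-1) ^ n"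
    using fib_Cassini_int[of n] by (simp add: power2_eq_square algebra_simps)
  have "sine_prod (fib (Suc (Suc n)) - 1) (fib_point (n + 2) 0) 0
      * sine_prod (fib (Suc n) - 1) (fib_point (n + 2) 0) 0 * (2 * sin (pi / G (n + 2))) = G (n + 2)"
    using sine_prod_mediant[of "int (fib (Suc n))" "fib (Suc n)" "int (fib n)" "fib (Suc (Suc n))"] det
    by (simp add: fib_point_def fib_neq_0_nat add.commute)
  then show ?thesis by (simp only: fib_prod_def p p')
qed

lemma fib_prod_mediant:
  defines "Q \<equiv> \<lambda>n. G n + G (n + 2)"
  shows "fib_prod (n + 2) (- 1 / Q n) * fib_prod n (1 / Q n) * (2 * sin (pi / Q n)) = Q n"
proof -
  have "int (fib (n + 2)) * int (fib (Suc n)) - int (fib n) * int (fib (Suc (n + 2))) = (-1) ^ n"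
    using fib_Cassini_int[of n] by (simp add: power2_eq_square algebra_simps)
  then show ?thesis
    using sine_prod_mediant[of "int (fib (n + 2))" "fib (Suc n)" "int (fib n)" "fib (Suc (n + 2))"]
    unfolding Q_def fib_prod_def fib_point_mediant
    by (simp add: fib_neq_0_nat add.commute del: fib.simps)
qed

section \<open>Numerical bounds for the sine, pi and the logarithm\<close>

lemma sin_bounds: 
  fixes x :: real assumes "x \<ge> 0"
  shows "x - x ^ 3 / 6 - x ^ 5 / 120 \<le> sin x" "sin x \<le> x - x ^ 3 / 6 + x ^ 5 / 120"
proof -
  have *: "(\<Sum>m<5. sin_coeff m * x ^ m) = x - x ^ 3 / 6"
    by (simp add: lessThan_nat_numeral sin_coeff_def fact_numeral)
  have "\<bar>sin x - (x - x ^ 3 / 6)\<bar> \<le> x ^ 5 / 120"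
    using Maclaurin_sin_bound[of x 5] assms unfolding * by (simp add: fact_numeral)
  then show "x - x ^ 3 / 6 - x ^ 5 / 120 \<le> sin x" "sin x \<le> x - x ^ 3 / 6 + x ^ 5 / 120"
    by linarith+
qed

text \<open>The value \<open>sin (pi / 6) = 1 / 2\<close> is compared with Taylor bounds at
  \<open>3.1 / 6 = 31/60\<close> and \<open>3.15 / 6 = 0.525\<close>.\<close>

lemma pi_bounds: "3.1 < pi" "pi < 3.15"
proof -
  show "3.1 < pi"
  proof (rule ccontr)
    assume "\<not> 3.1 < pi"
    then have "sin (pi / 6) \<le> sin (31/60)"
      using pi_ge_two by (intro sin_monotone_2pi_le) auto
    then show False
      using sin_bounds(2)[of "31/60"] by (simp add: sin_30 power_divide)
  qed
  show "pi < 3.15"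
  proof (rule ccontr)
    assume "\<not> pi < 3.15"
    then have "sin (0.525) \<le> sin (pi / 6)"
      using pi_less_4 by (intro sin_monotone_2pi_le) auto
    then show False
      using sin_bounds(1)[of "0.525"] by (simp add: sin_30 power_divide)
  qed
qed

lemma ln_le_of_quadratic:
  fixes x y :: real
  assumes "0 < y" "0 \<le> x" "y \<le> 1 + x + x\<^sup>2 / 2"
  shows "ln y \<le> x"
proof -
  have "y \<le> exp x"
    using exp_lower_Taylor_quadratic[OF assms(2)] assms(3) by linarith
  then have "ln y \<le> ln (exp x)"
    using assms(1) by (subst ln_le_cancel_iff) auto
  then show ?thesis by simp
qed

section \<open>The loop between upper and lower bounds near the convergents\<close>

text \<open>Growth of \<open>ln (fib_prod n z)\<close> from convergent \<open>n\<close> to its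
  mediant with convergent \<open>n + 2\<close>; the loop bounds the excess at \<open>n + 2\<close>
  by the one at \<open>n\<close>.\<close>

definition mediant_excess :: "nat \<Rightarrow> real" where
  "mediant_excess n = ln (fib_prod n (1 / (G n + G (n + 2)))) - ln (G n)"

lemma sin_pi_divide: 
  assumes "y \<ge> 2"
  shows "ln (2 * sin (pi / y)) \<le> ln (2 * pi) - ln y" "sin (pi / y) > 0"
proof -
  show pos: "sin (pi / y) > 0"
    using assms by (intro sin_gt_zero) (auto simp: divide_less_eq)
  have "2 * sin (pi / y) \<le> 2 * pi / y"
    using sin_x_le_x[of "pi / y"] assms by simp
  then have "ln (2 * sin (pi / y)) \<le> ln (2 * pi / y)"
    using pos assms by simp
  then show "ln (2 * sin (pi / y)) \<le> ln (2 * pi) - ln y"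
    using assms by (simp add: ln_div)
qed

lemma G_le_Suc: "G n \<le> G (Suc n)"
  using fib_Suc_mono[of "Suc n"] by (simp only: of_nat_le_iff)

lemma G_ge_1: "G n \<ge> 1"
  using fib_neq_0_nat[of "Suc n"] by (simp add: Suc_le_eq)

text \<open>
  The convergent \<open>z = 0\<close> lies between \<open>z > 0\<close> and the mediant \<open>z = - 1 / (G n + G (n + 2))\<close>, at which
  the product of length \<open>G n - 1\<close> controls the one of length \<open>G (n + 2) - 1\<close>.
\<close>

lemma fib_prod_extrapolate:
  assumes z: "0 \<le> z" "z * G (Suc n) < 1"
  shows "ln (fib_prod (n + 2) z) - ln (G (n + 2))
    \<le> z * (G n + G (n + 2)) * (ln (2 * pi * G n * G (n + 2) / (G n + G (n + 2))\<^sup>2) + mediant_excess n)"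
proof -
  define Q where "Q = G n + G (n + 2)"
  have pos: "G n > 0" "G (n + 2) > 0" by (rule G_pos)+
  have Q2: "Q \<ge> 2"
    unfolding Q_def using G_ge_1[of n] G_ge_1[of "n + 2"] by linarith
  \<comment> \<open>The weight for which the combination of \<open>- 1 / Q\<close> and
    \<open>z\<close> is the convergent 0.\<close>
  define t where "t = 1 / (1 + z * Q)"
  have zQ: "z * Q \<ge> 0" using z Q2 by simp
  then have t: "0 < t" "t \<le> 1" "(1 - t) = t * (z * Q)"
    by (auto simp: t_def field_simps)
  have m: "(1 - t) * (- 1 / Q) + t * z = 0"
    unfolding t(3) using Q2 by simp
  have dom: "- 1 < - 1 / Q * G n" "- 1 / Q * G (Suc n) < 1"
    using Q2 pos G_pos[of "Suc n"] unfolding Q_def by (auto simp: field_simps simp del: fib.simps)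
  have dom': "-1 < z * G n"
    using z pos by (metis less_eq_real_def mult_nonneg_nonneg neg_less_0_iff_less order_less_le_trans zero_less_one)
  have "(1 - t) * ln (fib_prod (n + 2) (- 1 / Q)) + t * ln (fib_prod (n + 2) z) \<le> ln (G (n + 2))"
    using fib_prod_log_concave[OF dom dom' z(2), of t] t unfolding m fib_prod_0 by simp
  also have "\<dots> = t * ((1 + z * Q) * ln (G (n + 2)))"
    using zQ by (simp add: t_def del: fib.simps)
  finally have "t * (z * Q * ln (fib_prod (n + 2) (- 1 / Q)) + ln (fib_prod (n + 2) z))
      \<le> t * ((1 + z * Q) * ln (G (n + 2)))"
    unfolding t(3) by (simp only: distrib_left mult.assoc)
  then have "z * Q * ln (fib_prod (n + 2) (- 1 / Q)) + ln (fib_prod (n + 2) z) \<le> (1 + z * Q) * ln (G (n + 2))"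
    unfolding mult_le_cancel_left_pos[OF t(1)] .
  then have 1: "ln (fib_prod (n + 2) z) - ln (G (n + 2))
      \<le> z * Q * (ln (G (n + 2)) - ln (fib_prod (n + 2) (- 1 / Q)))"
    by (simp add: algebra_simps del: fib.simps)
  \<comment> \<open>This expresses the value at \<open>- 1 / Q\<close> through
    \<open>fib_prod n (1 / Q)\<close>, hence through \<open>mediant_excess n\<close>; the bound
    \<open>sin x \<le> x\<close> brings in \<open>2 * pi\<close>.\<close>
  have prod: "fib_prod (n + 2) (- 1 / Q) * fib_prod n (1 / Q) * (2 * sin (pi / Q)) = Q"
    unfolding Q_def by (rule fib_prod_mediant)
  have P1: "fib_prod (n + 2) (- 1 / Q) > 0"
    using dom by (intro fib_prod_pos)
  have "fib_prod n (1 / Q) \<ge> 0"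
    by (simp add: fib_prod_def sine_prod_nonneg)
  moreover have "fib_prod n (1 / Q) \<noteq> 0"
    using prod Q2 by force
  ultimately have P2: "fib_prod n (1 / Q) > 0" by simp
  have "ln Q = ln (fib_prod (n + 2) (- 1 / Q)) + ln (fib_prod n (1 / Q)) + ln (2 * sin (pi / Q))"
    using P1 P2 sin_pi_divide(2)[OF Q2] by (subst prod[symmetric]) (simp add: ln_mult)
  then have "- ln (fib_prod (n + 2) (- 1 / Q)) \<le> ln (2 * pi) - 2 * ln Q + mediant_excess n + ln (G n)"
    using sin_pi_divide(1)[OF Q2] by (simp add: mediant_excess_def Q_def)
  moreover have "ln (2 * pi * G n * G (n + 2) / Q\<^sup>2) = ln (2 * pi) + ln (G n) + ln (G (n + 2)) - 2 * ln Q"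
    using pos Q2 by (simp add: ln_mult ln_div ln_realpow del: fib.simps)
  ultimately have "ln (G (n + 2)) - ln (fib_prod (n + 2) (- 1 / Q)) \<le> ln (2 * pi * G n * G (n + 2) / Q\<^sup>2) + mediant_excess n"
    by simp
  then have "z * Q * (ln (G (n + 2)) - ln (fib_prod (n + 2) (- 1 / Q)))
      \<le> z * Q * (ln (2 * pi * G n * G (n + 2) / Q\<^sup>2) + mediant_excess n)"
    using zQ by (rule mult_left_mono)
  with 1 show ?thesis unfolding Q_def by linarith
qed

lemma G_add_4: "G (n + 4) = 3 * G (n + 2) - G n"
proof -
  have *: "n + 4 = Suc (Suc (Suc (Suc n)))" by simp
  show ?thesis unfolding * by simp
qed

text \<open>Induction in steps of two: extrapolating to the next mediant contracts by at most 3/7,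
  and \<open>3 / 7 * (0.345 + 0.26) < 0.26\<close>. For \<open>n = 0\<close> and
  \<open>n = 1\<close> the products are empty and the excess is 0.\<close>

lemma mediant_excess_le: "mediant_excess n \<le> 0.26"
proof (induction n rule: fib.induct)
  case (3 n)
  define a b where "a = G (n + 2)" and "b = G n"
  have ab: "b > 0" "2 * b \<le> a"
    using G_pos[of n] G_le_Suc[of n] by (auto simp: a_def b_def)
  have G4: "G (n + 4) = 3 * a - b" unfolding a_def b_def by (rule G_add_4)
  have z: "1 / (4 * a - b) * G (Suc n) < 1"
    using ab by (simp add: a_def b_def field_simps)
  have z0: "0 \<le> 1 / (4 * a - b)" using ab by simp
  have *: "n + 2 + 2 = n + 4" by simp
  have e: "G (n + 2) + G (n + 2 + 2) = 4 * a - b"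
    unfolding * G4 by (simp add: a_def)
  have "mediant_excess (n + 2) \<le> 1 / (4 * a - b) * (b + a) * (ln (2 * pi * b * a / (b + a)\<^sup>2) + mediant_excess n)"
    using fib_prod_extrapolate[OF z0 z] 
    unfolding mediant_excess_def[of "n + 2"] e unfolding a_def[symmetric] b_def[symmetric] .
  also have "\<dots> \<le> 1 / (4 * a - b) * (b + a) * (0.345 + 0.26)"
  proof (intro mult_left_mono add_mono)
    \<comment> \<open>As \<open>b / a \<le> 1 / 2\<close>, the quotient
      \<open>b * a / (b + a)\<^sup>2\<close> is largest at \<open>a = 2 * b\<close>, with value
      2/9.\<close>
    have "9 * (b * a) \<le> 2 * (b + a)\<^sup>2"
    proof -
      have "0 \<le> (2 * a - b) * (a - 2 * b)" using ab by simp
      then show ?thesis by (simp add: algebra_simps power2_eq_square)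
    qed
    then have "b * a / (b + a)\<^sup>2 \<le> 2 / 9"
      using ab by (simp add: divide_le_eq)
    then have "2 * pi * (b * a / (b + a)\<^sup>2) \<le> 2 * 3.15 * (2 / 9)"
      using pi_bounds ab by (intro mult_mono) auto
    then have "2 * pi * b * a / (b + a)\<^sup>2 \<le> 1.4" by simp
    then show "ln (2 * pi * b * a / (b + a)\<^sup>2) \<le> 0.345"
      using ab by (intro ln_le_of_quadratic) (auto simp: power2_eq_square)
    show "mediant_excess n \<le> 0.26" using 3 by simp
  qed (use ab in auto)
  also have "\<dots> \<le> 3 / 7 * (0.345 + 0.26)"
    using ab by (intro mult_right_mono) (auto simp: field_simps)
  finally show ?case by simp
qed (auto simp: mediant_excess_def fib_prod_def)

text \<open>The map \<open>x \<mapsto> 1 / (1 + x)\<close> takes each ratio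
  \<open>G n / G (Suc n)\<close> to the next and sends [0.613, 0.626] into itself; the start is
  \<open>G 4 / G 5 = 5 / 8\<close>.\<close>

lemma ratio_bounds:
  assumes "n \<ge> 4"
  shows "0.38 * G (n + 2) \<le> G n" "G n \<le> 0.385 * G (n + 2)"
proof -
  have "0.613 * G (Suc n) \<le> G n \<and> G n \<le> 0.626 * G (Suc n)"
    using assms
  proof (induction n rule: dec_induct)
    case (step n)
    then show ?case by simp
  qed (simp add: eval_nat_numeral)
  then show "0.38 * G (n + 2) \<le> G n" "G n \<le> 0.385 * G (n + 2)"
    by simp_all
qed

text \<open>At convergent \<open>n + 4\<close> the extrapolated upper bound for
  \<open>fib_prod (n + 2)\<close> becomes a lower bound for \<open>fib_prod (n + 3)\<close> by
  \<open>fib_prod_adjacent\<close>. The loss is 0.2635 from the extrapolation plus 0.41 from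
  comparing the denominators.\<close>

lemma fib_prod_adjacent_lower:
  assumes "n \<ge> 4"
  shows "ln (fib_prod (n + 3) (1 / G (n + 4))) \<ge> ln (G (n + 3)) - 0.6735"
proof -
  define a b where "a = G (n + 2)" and "b = G n"
  have ab: "b > 0" "0.38 * a \<le> b" "b \<le> 0.385 * a"
    using G_pos[of n] ratio_bounds[OF assms] by (auto simp: a_def b_def)
  have G4: "G (n + 4) = 3 * a - b" unfolding a_def b_def by (rule G_add_4)
  have G3: "G (n + 3) = 2 * a - b" 
  proof -
    have *: "n + 3 = Suc (Suc (Suc n))" by simp
    show ?thesis unfolding a_def b_def * by simp
  qed
  have a: "a > 0" using ab by simp
  have z: "1 / (3 * a - b) * G (Suc n) < 1"
    using ab by (simp add: a_def b_def field_simps)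
  have "ln (fib_prod (n + 2) (1 / (3 * a - b))) - ln a
      \<le> 1 / (3 * a - b) * (b + a) * (ln (2 * pi * b * a / (b + a)\<^sup>2) + mediant_excess n)"
    using fib_prod_extrapolate[OF _ z] ab a unfolding a_def[symmetric] b_def[symmetric]
    by simp
  also have "\<dots> \<le> 1 / (3 * a - b) * (b + a) * (0.237 + 0.26)"
  proof (intro mult_left_mono add_mono)
    have "1.385\<^sup>2 * (b * a) \<le> 0.385 * (b + a)\<^sup>2"
    proof -
      have "0 \<le> (0.385 * a - b) * (a - 0.385 * b)" using ab by simp
      then show ?thesis by (simp add: algebra_simps power2_eq_square)
    qed
    then have "b * a / (b + a)\<^sup>2 \<le> 0.385 / 1.385\<^sup>2"
      using ab a by (simp add: field_simps)
    then have "2 * pi * (b * a / (b + a)\<^sup>2) \<le> 2 * 3.15 * (0.385 / 1.385\<^sup>2)"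
      using pi_bounds ab a by (intro mult_mono) auto
    then have "2 * pi * b * a / (b + a)\<^sup>2 \<le> 1.265" by (simp add: power2_eq_square)
    then show "ln (2 * pi * b * a / (b + a)\<^sup>2) \<le> 0.237"
      using ab a by (intro ln_le_of_quadratic) (auto simp: power2_eq_square)
    show "mediant_excess n \<le> 0.26" by (rule mediant_excess_le)
  qed (use ab a in auto)
  also have "\<dots> \<le> 0.53 * (0.237 + 0.26)"
    using ab a by (intro mult_right_mono) (auto simp: field_simps)
  finally have u: "ln (fib_prod (n + 2) (1 / (3 * a - b))) \<le> ln a + 0.2635"
    by simp
  have prod: "fib_prod (n + 3) (1 / (3 * a - b)) * fib_prod (n + 2) (1 / (3 * a - b)) * (2 * sin (pi / (3 * a - b))) = 3 * a - b"
    using fib_prod_adjacent[of "n + 2"] G4 by (simp add: eval_nat_numeral)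
  have "a \<ge> 1"
    unfolding a_def by (rule G_ge_1)
  then have Q2: "3 * a - b \<ge> 2"
    using ab by simp
  have "fib_prod (n + 3) (1 / (3 * a - b)) \<ge> 0" "fib_prod (n + 2) (1 / (3 * a - b)) \<ge> 0"
    by (simp_all add: fib_prod_def sine_prod_nonneg)
  moreover have "fib_prod (n + 3) (1 / (3 * a - b)) \<noteq> 0" "fib_prod (n + 2) (1 / (3 * a - b)) \<noteq> 0"
    using prod Q2 by force+
  ultimately have P: "fib_prod (n + 3) (1 / (3 * a - b)) > 0" "fib_prod (n + 2) (1 / (3 * a - b)) > 0"
    by simp_all
  have "ln (3 * a - b) = ln (fib_prod (n + 3) (1 / (3 * a - b))) + ln (fib_prod (n + 2) (1 / (3 * a - b)))
      + ln (2 * sin (pi / (3 * a - b)))"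
    using P sin_pi_divide(2)[OF Q2] by (subst prod[symmetric]) (simp add: ln_mult)
  then have 1: "ln (fib_prod (n + 3) (1 / (3 * a - b))) \<ge> 2 * ln (3 * a - b) - ln (2 * pi) - ln a - 0.2635"
    using u sin_pi_divide(1)[OF Q2] by linarith
  have "(2 * a - b) * a \<le> 0.2365 * (3 * a - b)\<^sup>2"
  proof -
    \<comment> \<open>Both factors are nonnegative because
      \<open>b \<le> 0.385 * a = 77 / 200 * a\<close>. Right side minus left side, times
      \<open>2 * 10 ^ 9\<close>, exceeds this product by a positive multiple of
      \<open>a * a\<close>.\<close>
    have "0 \<le> (77 * a - 200 * b) * (3279475 * a - 2365000 * b)"
      using ab a by (intro mult_nonneg_nonneg) auto
    moreover have "0 < a * a" using a by simp
    ultimately show ?thesis by (simp add: algebra_simps power2_eq_square)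
  qed
  then have "(2 * a - b) * a / (3 * a - b)\<^sup>2 \<le> 0.2365"
    using Q2 by (simp add: divide_le_eq)
  then have "2 * pi * ((2 * a - b) * a / (3 * a - b)\<^sup>2) \<le> 2 * 3.15 * 0.2365"
    using pi_bounds ab a by (intro mult_mono) auto
  then have "ln (2 * pi * ((2 * a - b) * a / (3 * a - b)\<^sup>2)) \<le> 0.41"
    using ab a by (intro ln_le_of_quadratic) (auto simp: power2_eq_square)
  moreover have "ln (2 * pi * ((2 * a - b) * a / (3 * a - b)\<^sup>2))
      = ln (2 * pi) + ln (2 * a - b) + ln a - 2 * ln (3 * a - b)"
    using ab a by (simp add: ln_mult ln_div ln_realpow)
  ultimately show ?thesis
    using 1 unfolding G3 G4 by simp
qed

subsection \<open>Zeckendorf blocks at the golden ratio\<close>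

definition gold :: real where "gold = (sqrt 5 - 1) / 2"

lemma gold_sq: "gold\<^sup>2 = 1 - gold"
  by (simp add: gold_def power2_eq_square field_simps)

lemma gold_bounds: "0.618 < gold" "gold < 0.6181"
proof -
  have "2.236 < sqrt 5" "sqrt 5 < 2.2362"
    by (rule real_less_rsqrt real_less_lsqrt; simp add: power2_eq_square)+
  then show "0.618 < gold" "gold < 0.6181"
    by (simp_all add: gold_def)
qed

lemma gold_pow_Suc2: "(-gold) ^ Suc (Suc n) = (-gold) ^ n * (1 - gold)"
  using gold_sq by (simp add: power2_eq_square)

lemma fib_gold: "G n * gold = real (fib n) - (-gold) ^ Suc n"
proof (induction n rule: fib.induct)
  case (3 n)
  have "G (Suc (Suc n)) * gold = G (Suc n) * gold + G n * gold"
    by (simp add: algebra_simps)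
  also have "\<dots> = real (fib (Suc (Suc n))) - (-gold) ^ Suc n * (1 - gold)"
    unfolding 3 by (simp add: algebra_simps)
  finally show ?case
    by (simp only: gold_pow_Suc2)
qed (use gold_sq in \<open>auto simp: power2_eq_square\<close>)

lemma fib_point_gold: "fib_point n (gold ^ Suc n) = gold"
  using fib_gold[of n] G_pos[of n]
  by (simp add: fib_point_def power_minus[of gold] field_simps del: fib.simps)

text \<open>Binet's formula multiplied by \<open>gold ^ Suc n\<close>. It comes from Cassini's
  identity with \<open>fib n = G n * gold + e\<close>, where the coefficient
  \<open>1 - gold - gold\<^sup>2\<close> of \<open>(G n)\<^sup>2\<close> vanishes.\<close>

lemma G_mult_gold_pow: "\<bar>sqrt 5 * (G n * gold ^ Suc n) - 1\<bar> = (gold\<^sup>2) ^ Suc n"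
proof -
  define e where "e = (-gold) ^ Suc n"
  have ee: "e\<^sup>2 = (gold\<^sup>2) ^ Suc n"
    unfolding e_def by (metis power2_minus power_mult mult.commute)
  have f: "real (fib n) = G n * gold + e"
    using fib_gold[of n] by (simp add: e_def)
  have s5: "sqrt 5 = 1 + 2 * gold"
    by (simp add: gold_def field_simps)
  have "(G n)\<^sup>2 - (G n + real (fib n)) * real (fib n) = (-1) ^ n"
    using fib_Cassini_real[of n] by simp
  moreover have "(G n)\<^sup>2 - (G n + real (fib n)) * real (fib n)
      = (G n)\<^sup>2 * (1 - gold - gold\<^sup>2) - (sqrt 5 * (G n * e) + e\<^sup>2)"
    unfolding f s5 by (simp add: algebra_simps power2_eq_square)
  ultimately have "sqrt 5 * (G n * e) + (-1) ^ n = - e\<^sup>2"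
    unfolding gold_sq by simp
  moreover have "sqrt 5 * (G n * e) + (-1) ^ n = (-1) ^ n * (1 - sqrt 5 * (G n * gold ^ Suc n))"
    by (simp add: e_def power_minus[of gold] algebra_simps del: fib.simps)
  ultimately have "\<bar>(-1) ^ n * (1 - sqrt 5 * (G n * gold ^ Suc n))\<bar> = \<bar>- e\<^sup>2\<bar>"
    by simp
  then show ?thesis
    unfolding ee by (simp add: abs_mult power_abs abs_minus_commute del: fib.simps)
qed

lemma gold_pow_le: "(gold\<^sup>2) ^ 5 \<le> 0.0082"
proof -
  have "(gold\<^sup>2) ^ 5 \<le> (0.382 :: real) ^ 5"
    using gold_bounds by (intro power_mono) (auto simp: gold_sq)
  then show ?thesis by (simp add: power_divide)
qed

text \<open>The sequence \<open>A n\<close> of the overview.\<close>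

definition gold_prod :: "nat \<Rightarrow> real" where
  "gold_prod n = sine_prod (fib (Suc n) - 1) gold 0"

lemma G_gold_bounds:
  assumes "n \<ge> 4"
  shows "0.9918 \<le> sqrt 5 * (G n * gold ^ Suc n)" "sqrt 5 * (G n * gold ^ Suc n) \<le> 1.0082"
proof -
  have "(gold\<^sup>2) ^ Suc n \<le> (gold\<^sup>2) ^ 5"
    using assms gold_bounds by (intro power_decreasing) (auto simp: gold_sq)
  then have "\<bar>sqrt 5 * (G n * gold ^ Suc n) - 1\<bar> \<le> 0.0082"
    unfolding G_mult_gold_pow using gold_pow_le by (rule order_trans)
  then show "0.9918 \<le> sqrt 5 * (G n * gold ^ Suc n)" "sqrt 5 * (G n * gold ^ Suc n) \<le> 1.0082"
    unfolding abs_le_iff by (simp_all del: fib.simps power_Suc)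
qed

text \<open>Interpolation between convergents \<open>n + 3\<close> (no loss) and
  \<open>n + 4\<close> (loss 0.6735). The golden ratio lies at the fraction \<open>t\<close> of the
  way, close to \<open>1 / (sqrt 5 * gold)\<close>, and
  \<open>0.73 * 0.6735 < 1 / 2\<close>.\<close>

lemma gold_prod_lower_ln:
  assumes "n \<ge> 4"
  shows "ln (gold_prod (n + 3)) \<ge> ln (G (n + 3)) - 1 / 2"
proof -
  define t where "t = gold ^ (n + 4) * G (n + 4)"
  have G4: "G (n + 4) > 0" by (rule G_pos)
  have t0: "t \<ge> 0"
    using gold_bounds by (simp add: t_def)
  have "4 \<le> n + 4" by simp
  from G_gold_bounds(2)[OF this] have "sqrt 5 * gold * t \<le> 1.0082"
    unfolding t_def power_Suc by (simp only: mult_ac)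
  moreover have "1.3818 \<le> sqrt 5 * gold"
    using gold_bounds gold_sq by (simp add: gold_def power2_eq_square field_simps)
  then have "1.3818 * t \<le> sqrt 5 * gold * t"
    using t0 by (rule mult_right_mono)
  ultimately have "1.3818 * t \<le> 1.0082"
    by (meson order_trans)
  then have t1: "t \<le> 0.73"
    by simp
  have dom: "-1 < 1 / G (n + 4) * G (n + 1)" "1 / G (n + 4) * G (Suc (n + 1)) < 1"
  proof -
    have "G (n + 1) / G (n + 4) > 0"
      by (intro divide_pos_pos G_pos)
    then show "-1 < 1 / G (n + 4) * G (n + 1)"
      by (simp del: fib.simps)
    have "G (n + 4) = G (n + 2) + G (n + 3)"
      using G_rec[of "n + 2"] by (simp add: eval_nat_numeral)
    then show "1 / G (n + 4) * G (Suc (n + 1)) < 1"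
      using G4 G_pos[of "n + 3"] by simp
  qed
  have "(1 - t) * ln (fib_prod (n + 1 + 2) 0) + t * ln (fib_prod (n + 1 + 2) (1 / G (n + 4)))
      \<le> ln (fib_prod (n + 1 + 2) ((1 - t) * 0 + t * (1 / G (n + 4))))"
    using dom t0 t1 by (intro fib_prod_log_concave) auto
  moreover have "fib_prod (n + 1 + 2) ((1 - t) * 0 + t * (1 / G (n + 4))) = gold_prod (n + 3)"
    using G4 fib_point_gold[of "n + 3"]
    by (simp add: t_def fib_prod_def gold_prod_def eval_nat_numeral)
  moreover have "fib_prod (n + 1 + 2) 0 = G (n + 3)"
    by (simp only: fib_prod_0) (simp add: eval_nat_numeral)
  moreover have "n + 1 + 2 = n + 3" by simp
  ultimately have "(1 - t) * ln (G (n + 3)) + t * ln (fib_prod (n + 3) (1 / G (n + 4))) \<le> ln (gold_prod (n + 3))"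
    by metis
  moreover have "t * ln (fib_prod (n + 3) (1 / G (n + 4))) \<ge> t * (ln (G (n + 3)) - 0.6735)"
    using fib_prod_adjacent_lower[OF assms] t0 by (rule mult_left_mono)
  ultimately have "ln (G (n + 3)) - 0.6735 * t \<le> ln (gold_prod (n + 3))"
    by (simp add: algebra_simps)
  moreover have "0.6735 * t \<le> 1 / 2"
    using t1 by simp
  ultimately show ?thesis by linarith
qed

section \<open>Multiples of the golden ratio modulo 1, and reflection\<close>

text \<open>In the coordinates of \<open>fib_basis\<close> the error is
  \<open>gold ^ n * \<bar>X - gold * Y\<bar>\<close>. For \<open>0 < r < G n\<close> the integer
  \<open>X\<close> is nonzero and \<open>Y\<close> does not have the same sign, so the second factor
  is at least 1.\<close>

lemma gold_approx:
  fixes j :: int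
  assumes r: "1 \<le> r" "r < fib (Suc n)"
  shows "gold ^ n \<le> \<bar>real r * gold - of_int j\<bar>"
proof (cases n)
  case (Suc k)
  define X Y where "X = (-1) ^ Suc k * (j * int (fib (Suc (Suc k))) - int r * int (fib (Suc k)))"
    and "Y = (-1) ^ k * (j * int (fib (Suc k)) - int r * int (fib k))"
  have X: "of_int X = (-1) ^ Suc k * (of_int j * G (Suc k) - real r * G k)"
    and Y: "of_int Y = (-1) ^ k * (of_int j * G k - real r * real (fib k))"
    by (simp_all add: X_def Y_def)
  have rXY: "real r = G k * of_int X + G (Suc k) * of_int Y"
    and jXY: "of_int j = real (fib k) * of_int X + G k * of_int Y"
    unfolding X Y by (rule fib_basis)+
  have "real r * gold - of_int j = of_int X * (G k * gold - real (fib k)) + of_int Y * (G (Suc k) * gold - G k)"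
    unfolding rXY jXY by (simp add: algebra_simps)
  also have "\<dots> = - ((-gold) ^ Suc k) * (of_int X - gold * of_int Y)"
    unfolding fib_gold by (simp add: algebra_simps)
  finally have eq: "\<bar>real r * gold - of_int j\<bar> = gold ^ n * \<bar>of_int X - gold * of_int Y\<bar>"
    using gold_bounds by (simp add: Suc abs_mult power_abs)
  have rZ: "int r = int (fib (Suc k)) * X + int (fib (Suc (Suc k))) * Y"
  proof -
    have "real_of_int (int r) = real_of_int (int (fib (Suc k)) * X + int (fib (Suc (Suc k))) * Y)"
      using rXY by simp
    then show ?thesis by (simp only: of_int_eq_iff)
  qed
  have pos: "int (fib (Suc k)) > 0" "int (fib (Suc (Suc k))) > 0"
    by (simp_all only: of_nat_0_less_iff fib_neq_0_nat zero_less_Suc)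
  have r': "0 < int r" "int r < int (fib (Suc (Suc k)))"
    using r Suc by auto
  have "1 \<le> \<bar>of_int X - gold * of_int Y\<bar>"
  proof (cases "X \<ge> 1")
    case True
    have "Y \<le> 0"
    proof (rule ccontr)
      assume "\<not> Y \<le> 0"
      then have "int (fib (Suc (Suc k))) * 1 \<le> int (fib (Suc (Suc k))) * Y"
        using pos by (intro mult_left_mono) auto
      moreover have "int (fib (Suc k)) * X > 0" using pos True by simp
      ultimately show False using rZ r' by linarith
    qed
    then have "gold * of_int Y \<le> 0"
      using gold_bounds by (simp add: mult_nonneg_nonpos)
    then show ?thesis using True by linarith
  next
    case False
    have "X \<noteq> 0"
    proof
      assume "X = 0"
      then have *: "int r = int (fib (Suc (Suc k))) * Y" using rZ by simp
      then have "Y > 0" using r' pos by (metis zero_less_mult_pos)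
      then have "int (fib (Suc (Suc k))) * 1 \<le> int (fib (Suc (Suc k))) * Y"
        using pos by (intro mult_left_mono) auto
      then show False using * r' by linarith
    qed
    then have X1: "X \<le> -1" using False by linarith
    have "Y \<ge> 0"
    proof (rule ccontr)
      assume "\<not> Y \<ge> 0"
      then have "int (fib (Suc (Suc k))) * Y < 0" "int (fib (Suc k)) * X < 0"
        using pos X1 by (simp_all add: mult_pos_neg)
      then show False using rZ r' by linarith
    qed
    then have "gold * of_int Y \<ge> 0"
      using gold_bounds by simp
    then show ?thesis using X1 by linarith
  qed
  then show ?thesis
    unfolding eq using gold_bounds by simp
qed (use r in auto)

lemma gold_not_int:
  assumes "1 \<le> r" "r < fib (Suc n)" "\<bar>x\<bar> < gold ^ n"
  shows "real r * gold + x \<notin> \<int>"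
proof
  assume "real r * gold + x \<in> \<int>"
  then obtain j where "real r * gold + x = of_int j" by (elim Ints_cases)
  then show False
    using gold_approx[OF assms(1,2), of j] assms(3) by auto
qed

lemma gold_prod_pos: "gold_prod n > 0"
  unfolding gold_prod_def using gold_bounds
  by (intro sine_prod_pos gold_not_int[of _ n]) (use fib_neq_0_nat[of "Suc n"] in auto)

text \<open>Log-concavity in the shift; by \<open>gold_approx\<close> no factor vanishes for shifts
  below \<open>gold ^ n\<close> in absolute value.\<close>

lemma sine_prod_gold_ge_min:
  assumes N: "N < fib (Suc n)" and x: "\<bar>x\<bar> < gold ^ n" "\<bar>y\<bar> < gold ^ n" and t: "0 \<le> t" "t \<le> 1"
  shows "min (sine_prod N gold x) (sine_prod N gold y) \<le> sine_prod N gold ((1 - t) * x + t * y)"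
proof -
  let ?m = "min (sine_prod N gold x) (sine_prod N gold y)"
  have lin: "(1 - s) * gold + s * gold = gold" for s by (simp add: algebra_simps)
  have conv: "\<bar>(1 - s) * x + s * y\<bar> < gold ^ n" if s: "0 \<le> s" "s \<le> 1" for s
  proof -
    have "\<bar>(1 - s) * x + s * y\<bar> \<le> (1 - s) * \<bar>x\<bar> + s * \<bar>y\<bar>"
      using s by (intro order_trans[OF abs_triangle_ineq]) (simp add: abs_mult)
    also have "\<dots> < gold ^ n"
      using x s by (intro convex_bound_lt) auto
    finally show ?thesis .
  qed
  have pos: "sine_prod N gold z > 0" if "\<bar>z\<bar> < gold ^ n" for z
    using that N by (intro sine_prod_pos gold_not_int[of _ n]) auto
  have "ln ?m = (1 - t) * ln ?m + t * ln ?m" by (simp add: algebra_simps)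
  also have "\<dots> \<le> (1 - t) * ln (sine_prod N gold x) + t * ln (sine_prod N gold y)"
    using t pos x by (intro add_mono mult_left_mono) auto
  also have "\<dots> \<le> ln (sine_prod N ((1 - t) * gold + t * gold) ((1 - t) * x + t * y))"
    by (intro sine_prod_log_concave t, unfold lin, rule gold_not_int[of _ n]) (use N conv in auto)
  finally show ?thesis
    unfolding lin using pos x conv[OF t] by (subst (asm) ln_le_cancel_iff) auto
qed

text \<open>Modulo 1 the shift \<open>(-gold) ^ Suc m\<close> is \<open>- G m * gold\<close>, so it
  reflects at \<open>G m\<close>.\<close>

lemma sine_prod_gold_reflect:
  assumes "N < fib (Suc m)"
  shows "sine_prod N gold ((-gold) ^ Suc m) * sine_prod (fib (Suc m) - N - 1) gold 0 = gold_prod m"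
proof -
  have "(-gold) ^ Suc m = - G m * gold + real (fib m)"
    using fib_gold[of m] by simp
  then have "sine_prod N gold ((-gold) ^ Suc m) = sine_prod N gold (- G m * gold)"
    using sine_prod_add_int[of "real (fib m)" N gold "- G m * gold"] by simp
  then show ?thesis
    using sine_prod_reflect[OF assms, of gold] by (simp only: gold_prod_def)
qed

text \<open>Reflection at \<open>G (n + 2) = G (n + 1) + G n\<close>: a block as long as one summand
  leaves the product belonging to the other. These are the end point values of the blocks.\<close>

lemma gold_prod_ratio:
  "gold_prod (n + 2) = gold_prod (n + 1) * sine_prod (fib (Suc n)) gold ((-gold) ^ (n + 3))"
  "gold_prod (n + 2) = gold_prod n * sine_prod (fib (Suc (Suc n))) gold ((-gold) ^ (n + 3))"
proof -
  have pos: "0 < fib (Suc n)" "0 < fib (Suc (Suc n))"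
    by (simp_all only: fib_neq_0_nat zero_less_Suc)
  then have lt: "fib (Suc n) < fib (Suc (n + 2))" "fib (Suc (Suc n)) < fib (Suc (n + 2))"
    by simp_all
  have diff: "fib (Suc (n + 2)) - fib (Suc n) - 1 = fib (Suc (n + 1)) - 1"
    "fib (Suc (n + 2)) - fib (Suc (Suc n)) - 1 = fib (Suc n) - 1"
    by simp_all
  have e: "Suc (n + 2) = n + 3" by simp
  show "gold_prod (n + 2) = gold_prod (n + 1) * sine_prod (fib (Suc n)) gold ((-gold) ^ (n + 3))"
    using sine_prod_gold_reflect[OF lt(1)] unfolding diff unfolding e gold_prod_def[of "n + 1"]
    by (simp only: mult.commute)
  show "gold_prod (n + 2) = gold_prod n * sine_prod (fib (Suc (Suc n))) gold ((-gold) ^ (n + 3))"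
    using sine_prod_gold_reflect[OF lt(2)] unfolding diff unfolding e gold_prod_def[of n]
    by (simp only: mult.commute)
qed

text \<open>
  The product without its last factor \<open>r = G n\<close> takes the value \<open>gold_prod n\<close> at both ends of the
  segment from \<open>0\<close> to \<open>(-gold) ^ Suc n\<close>.
\<close>

lemma gold_prod_step: "gold_prod (n + 1) * (gold_prod n * (2 * sin (pi * gold ^ (n + 2)))) \<le> gold_prod (n + 2)"
proof -
  let ?N = "fib (Suc n) - 1"
  have N: "?N < fib (Suc n)" "Suc ?N = fib (Suc n)"
    using fib_neq_0_nat[of "Suc n"] by auto
  have g: "0 \<le> gold\<^sup>2" "gold\<^sup>2 \<le> 1" "\<bar>0\<bar> < gold ^ n" "\<bar>(-gold) ^ Suc n\<bar> < gold ^ n"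
    using gold_bounds by (simp_all add: gold_sq power_abs abs_mult)
  have "sine_prod ?N gold ((-gold) ^ Suc n) = gold_prod n"
    using sine_prod_gold_reflect[OF N(1)] N(1) by simp
  moreover have "sine_prod ?N gold 0 = gold_prod n"
    by (simp add: gold_prod_def)
  moreover have "(1 - gold\<^sup>2) * 0 + gold\<^sup>2 * (-gold) ^ Suc n = (-gold) ^ (n + 3)"
    by (simp add: power2_eq_square power3_eq_cube power_add)
  ultimately have ge: "gold_prod n \<le> sine_prod ?N gold ((-gold) ^ (n + 3))"
    using sine_prod_gold_ge_min[OF N(1) g(3,4,1,2)] by simp
  \<comment> \<open>The missing factor \<open>r = G n\<close>: its argument is at distance
    \<open>gold ^ (n + 2)\<close> from an integer.\<close>
  have "G n * gold + (-gold) ^ (n + 3) = real (fib n) - (-gold) ^ Suc n * (1 - gold\<^sup>2)"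
    unfolding fib_gold by (simp add: power2_eq_square power3_eq_cube power_add algebra_simps)
  also have "\<dots> = real (fib n) + (-gold) ^ (n + 2)"
    by (simp add: gold_sq)
  finally have "\<bar>sin (pi * (G n * gold + (-gold) ^ (n + 3)))\<bar> = \<bar>sin (pi * (gold ^ (n + 2)))\<bar>"
    by (intro abs_sin_pi_eq_int) (cases "even n", auto)
  moreover have "sin (pi * (gold ^ (n + 2))) \<ge> 0"
    using gold_bounds power_le_one[of gold "n + 2"] by (intro sin_ge_zero) auto
  moreover have "sine_prod (fib (Suc n)) gold ((-gold) ^ (n + 3))
      = sine_prod ?N gold ((-gold) ^ (n + 3)) * \<bar>2 * sin (pi * (G n * gold + (-gold) ^ (n + 3)))\<bar>"
    using sine_prod_Suc[of ?N] N(2) by simp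
  ultimately have "gold_prod n * (2 * sin (pi * gold ^ (n + 2))) \<le> sine_prod (fib (Suc n)) gold ((-gold) ^ (n + 3))"
    using ge by (simp add: abs_mult mult_right_mono del: fib.simps)
  then show ?thesis
    unfolding gold_prod_ratio(1) using gold_prod_pos[of "n + 1"] by (intro mult_left_mono) auto
qed

section \<open>Eventual monotonicity of \<open>gold_prod\<close>\<close>

lemma exp_half_le: "exp (1 / 2 :: real) \<le> 1.68"
proof -
  have "0.95 \<le> exp (- 0.05 :: real)"
    using exp_ge_add_one_self[of "- 0.05 :: real"] by simp
  then have "(0.95 :: real) ^ 10 \<le> exp (- 0.05) ^ 10"
    by (intro power_mono) auto
  also have "exp (- 0.05 :: real) ^ 10 = exp (of_nat 10 * - 0.05)"
    by (rule exp_of_nat_mult[symmetric])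
  also have "\<dots> = 1 / exp (1 / 2)"
    by (simp add: exp_minus inverse_eq_divide)
  finally have "exp (1 / 2 :: real) * 0.95 ^ 10 \<le> 1"
    by (simp add: field_simps)
  then show ?thesis
    by (simp add: power_divide)
qed

text \<open>The product \<open>G m * 2 * sin (pi * gold ^ (m + 2))\<close> tends to
  \<open>2 * pi * gold / sqrt 5\<close>, about 1.737, which beats the loss factor
  \<open>exp (1 / 2) \<le> 1.68\<close>. The bound \<open>gold_prod_lower_ln\<close> is applied at
  \<open>m - 3\<close>, which must be at least 4.\<close>

lemma gold_prod_sin_ge_1:
  assumes "m \<ge> 7"
  shows "gold_prod m * (2 * sin (pi * gold ^ (m + 2))) \<ge> 1"
proof -
  define x where "x = pi * gold ^ (m + 2)"
  have "gold ^ (m + 2) \<le> gold ^ 9"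
    using assms gold_bounds by (intro power_decreasing) auto
  also have "\<dots> \<le> 0.6181 ^ 9"
    using gold_bounds by (intro power_mono) auto
  also have "\<dots> \<le> 0.02" by (simp add: power_divide)
  finally have g: "gold ^ (m + 2) \<le> 0.02" .
  have "x \<le> 3.15 * 0.02"
    unfolding x_def using pi_bounds g gold_bounds by (intro mult_mono) auto
  then have x: "0 < x" "x \<le> 0.1"
    using gold_bounds by (auto simp: x_def)
  have "x ^ 2 \<le> 0.1 ^ 2" "x ^ 4 \<le> 0.1 ^ 4"
    using x by (intro power_mono; simp)+
  then have "0.99 \<le> 1 - x ^ 2 / 6 - x ^ 4 / 120"
    by (simp add: power_divide)
  then have "x * 0.99 \<le> x * (1 - x ^ 2 / 6 - x ^ 4 / 120)"
    using x by (intro mult_left_mono) auto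
  also have "\<dots> = x - x ^ 3 / 6 - x ^ 5 / 120"
    by (simp add: algebra_simps eval_nat_numeral)
  also have "\<dots> \<le> sin x"
    using x by (intro sin_bounds) auto
  finally have sinx: "0.99 * x \<le> sin x" by simp
  have "1.68 * 2.2362 \<le> (0.99 * 2 * 3.1 * 0.618) * (0.9918 :: real)" by simp
  also have "\<dots> \<le> (0.99 * 2 * pi * gold) * (sqrt 5 * (G m * gold ^ Suc m))"
    using G_gold_bounds(1)[of m] assms pi_bounds gold_bounds by (intro mult_mono) auto
  also have "\<dots> = sqrt 5 * (G m * (2 * (0.99 * x)))"
    by (simp add: x_def algebra_simps)
  also have "\<dots> \<le> sqrt 5 * (G m * (2 * sin x))"
    using sinx by (intro mult_left_mono) auto
  also have "\<dots> \<le> 2.2362 * (G m * (2 * sin x))"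
    using sinx x gold_bounds G_pos[of m] by (intro mult_right_mono) (auto simp: gold_def)
  finally have G: "1.68 \<le> G m * (2 * sin x)" by (simp add: mult.commute)
  have "ln (gold_prod m) \<ge> ln (G m) - 1 / 2"
    using gold_prod_lower_ln[of "m - 3"] assms by simp
  then have "exp (ln (G m)) \<le> exp (ln (gold_prod m) + 1 / 2)" by simp
  then have "G m \<le> gold_prod m * exp (1 / 2)"
    using gold_prod_pos[of m] G_pos[of m] by (simp only: exp_add exp_ln)
  also have "\<dots> \<le> gold_prod m * 1.68"
    using exp_half_le gold_prod_pos[of m] by (intro mult_left_mono) auto
  finally have "G m * (2 * sin x) \<le> gold_prod m * 1.68 * (2 * sin x)"
    using sinx x by (intro mult_right_mono) auto
  with G have "1.68 \<le> gold_prod m * 1.68 * (2 * sin x)" by (rule order_trans)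
  then show ?thesis unfolding x_def by (simp add: mult_ac)
qed

lemma gold_prod_mono:
  assumes "m \<ge> 8"
  shows "gold_prod m \<le> gold_prod (Suc m)"
proof -
  have "gold_prod m * 1 \<le> gold_prod m * (gold_prod (m - 1) * (2 * sin (pi * gold ^ (m - 1 + 2))))"
    using assms gold_prod_sin_ge_1[of "m - 1"] gold_prod_pos[of m] by (intro mult_left_mono) auto
  also have "\<dots> \<le> gold_prod (Suc m)"
    using gold_prod_step[of "m - 1"] assms by (simp add: eval_nat_numeral)
  finally show ?thesis by simp
qed

section \<open>Block bounds and their assembly\<close>

text \<open>The two quotients are the end point values of the block of length
  \<open>G (n + 1)\<close>. The cap 1 lets the induction also multiply in bounds for blocks absent
  from the Zeckendorf expansion.\<close>

definition block_bound :: "nat \<Rightarrow> real" where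
  "block_bound n = min 1 (min (gold_prod (n + 2) / gold_prod n) (gold_prod (n + 3) / gold_prod (n + 2)))"

lemma block_bound_pos: "0 < block_bound n" and block_bound_le_1: "block_bound n \<le> 1"
  using gold_prod_pos by (simp_all add: block_bound_def)

lemma block_bound_eq_1:
  assumes "n \<ge> 8"
  shows "block_bound n = 1"
proof -
  have "gold_prod n \<le> gold_prod (n + 2)" "gold_prod (n + 2) \<le> gold_prod (n + 3)"
    using gold_prod_mono[of n] gold_prod_mono[of "Suc n"] gold_prod_mono[of "n + 2"] assms by (simp_all add: eval_nat_numeral)
  then show ?thesis
    using gold_prod_pos[of n] gold_prod_pos[of "n + 2"] by (simp add: block_bound_def)
qed

text \<open>As \<open>gold + gold\<^sup>2 = 1\<close>, the number \<open>s + gold\<close> lies in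
  [0, 1]; it is the weight of the end point \<open>(-gold) ^ (n + 4)\<close> against
  \<open>(-gold) ^ (n + 3)\<close>.\<close>

lemma block_lower:
  assumes s: "- gold \<le> s" "s \<le> gold\<^sup>2"
  shows "block_bound n \<le> sine_prod (fib (Suc (Suc n))) gold ((-gold) ^ (n + 2) * s)"
proof -
  have lt: "fib (Suc (Suc n)) < fib (Suc (n + 2))"
    using fib_neq_0_nat[of "Suc n"] by simp
  have "0 < gold" "gold < 1"
    using gold_bounds by simp_all
  then have g: "gold ^ (n + 3) < gold ^ (n + 2)" "gold ^ (n + 4) < gold ^ (n + 2)"
    using power_strict_decreasing[of "n + 2" "n + 3" gold] power_strict_decreasing[of "n + 2" "n + 4" gold]
    by simp_all
  have "(1 - (s + gold)) * (-gold) ^ (n + 3) + (s + gold) * (-gold) ^ (n + 4)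
      = (-gold) ^ (n + 2) * (s * (gold + gold\<^sup>2) + gold * (gold + gold\<^sup>2 - 1))"
    by (simp add: eval_nat_numeral algebra_simps)
  also have "\<dots> = (-gold) ^ (n + 2) * s"
    by (simp add: gold_sq)
  finally have x: "(1 - (s + gold)) * (-gold) ^ (n + 3) + (s + gold) * (-gold) ^ (n + 4) = (-gold) ^ (n + 2) * s" .
  have "gold_prod (n + 2) / gold_prod n = sine_prod (fib (Suc (Suc n))) gold ((-gold) ^ (n + 3))"
    using gold_prod_ratio(2)[of n] gold_prod_pos[of n] by simp
  moreover have "gold_prod (n + 3) / gold_prod (n + 2) = sine_prod (fib (Suc (Suc n))) gold ((-gold) ^ (n + 4))"
    using gold_prod_ratio(1)[of "Suc n"] gold_prod_pos[of "n + 2"] by (simp add: eval_nat_numeral)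
  moreover have "min (sine_prod (fib (Suc (Suc n))) gold ((-gold) ^ (n + 3)))
      (sine_prod (fib (Suc (Suc n))) gold ((-gold) ^ (n + 4)))
    \<le> sine_prod (fib (Suc (Suc n))) gold ((-gold) ^ (n + 2) * s)"
    unfolding x[symmetric]
    by (rule sine_prod_gold_ge_min[OF lt]) (use g gold_bounds s in \<open>auto simp: power_abs gold_sq\<close>)
  ultimately show ?thesis
    unfolding block_bound_def by linarith
qed

text \<open>
  The condition on \<open>s\<close> is inherited when the largest Zeckendorf term is split off: \<open>s\<close> becomes
  \<open>gold\<^sup>2 * (s - 1)\<close>, or \<open>- gold * s\<close> if that term is absent.
\<close>

lemma sine_prod_gold_lower:
  assumes "N < fib (Suc n)" "- gold \<le> s" "s \<le> gold\<^sup>2"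
  shows "(\<Prod>j<n. block_bound j) \<le> sine_prod N gold ((-gold) ^ n * s)"
  using assms
proof (induction n arbitrary: N s rule: fib.induct)
  case (3 n)
  let ?K = "\<lambda>n. \<Prod>j<n. block_bound j"
  have K: "?K n > 0" for n
    using block_bound_pos by (intro prod_pos) auto
  have bb: "0 < block_bound n" "block_bound n \<le> 1" "block_bound (Suc n) \<le> 1" for n
    by (rule block_bound_pos block_bound_le_1)+
  have g: "0 < gold" "gold < 1" using gold_bounds by auto
  show ?case
  proof (cases "N < fib (Suc (Suc n))")
    case True
    have "gold * s \<le> gold * gold\<^sup>2" "gold * (- gold) \<le> gold * s"
      using 3 g by (intro mult_left_mono; simp)+
    moreover have "gold * gold\<^sup>2 \<le> gold"
      using g by (simp add: gold_sq)
    ultimately have "?K (Suc n) \<le> sine_prod N gold ((-gold) ^ Suc n * (- gold * s))"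
      using True by (intro 3) (auto simp: power2_eq_square)
    moreover have "?K (Suc (Suc n)) \<le> ?K (Suc n)"
      using K[of "Suc n"] bb(3)[of n] by (simp add: mult_left_le)
    ultimately show ?thesis by (simp add: mult_ac)
  next
    case False
    \<comment> \<open>Greedy Zeckendorf step: the remainder is below \<open>fib (Suc n)\<close>, so
      the index drops by two.\<close>
    define M where "M = N - fib (Suc (Suc n))"
    have M: "N = fib (Suc (Suc n)) + M" "M < fib (Suc n)"
      using False 3(3) by (auto simp: M_def)
    let ?x = "(-gold) ^ (n + 2) * s"
    have "gold\<^sup>2 * (1 + gold) = (1 - gold) * (1 + gold)"
      by (simp only: gold_sq)
    also have "\<dots> = 1 - gold\<^sup>2"
      by (simp add: algebra_simps power2_eq_square)
    finally have c: "gold\<^sup>2 * (1 + gold) = gold"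
      by (simp add: gold_sq)
    have "gold\<^sup>2 * (- gold - 1) \<le> gold\<^sup>2 * (s - 1)" "gold\<^sup>2 * (s - 1) \<le> gold\<^sup>2 * (gold\<^sup>2 - 1)"
      using 3 by (intro mult_left_mono; simp)+
    moreover have "gold\<^sup>2 * (- gold - 1) = - gold"
      using c by (simp add: algebra_simps)
    moreover have "gold\<^sup>2 * (gold\<^sup>2 - 1) \<le> gold\<^sup>2 * 1"
      using g by (intro mult_left_mono) (auto simp: gold_sq)
    ultimately have "?K n \<le> sine_prod M gold ((-gold) ^ n * (gold\<^sup>2 * (s - 1)))"
      using M by (intro 3) auto
    also have "(-gold) ^ n * (gold\<^sup>2 * (s - 1)) = ?x - (-gold) ^ (n + 2)"
      by (simp add: algebra_simps power2_eq_square)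
    \<comment> \<open>By \<open>fib_gold\<close>, skipping \<open>G (Suc n)\<close> factors shifts
      by \<open>- (-gold) ^ (n + 2)\<close> modulo 1.\<close>
    also have "sine_prod M gold (?x - (-gold) ^ (n + 2)) = sine_prod M gold (?x + G (Suc n) * gold)"
    proof -
      have *: "?x + G (Suc n) * gold = ?x - (-gold) ^ (n + 2) + G n"
        unfolding fib_gold by simp
      show ?thesis
        unfolding * by (rule sine_prod_add_int[symmetric]) simp
    qed
    finally have 1: "?K n \<le> sine_prod M gold (?x + G (Suc n) * gold)" .
    have "?K (Suc (Suc n)) = block_bound n * (block_bound (Suc n) * ?K n)"
      by (simp add: mult_ac)
    also have "\<dots> \<le> block_bound n * ?K n"
      using K[of n] bb by (intro mult_left_mono) (auto simp: mult_le_cancel_right1 less_imp_le)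
    also have "\<dots> \<le> sine_prod (fib (Suc (Suc n))) gold ?x * sine_prod M gold (?x + G (Suc n) * gold)"
      using 1 block_lower[of s n] 3 K[of n] bb(1)[of n]
      by (intro mult_mono) (auto simp: sine_prod_nonneg)
    also have "\<dots> = sine_prod N gold ?x"
      unfolding M(1) sine_prod_add ..
    finally show ?thesis by simp
  qed
qed (auto simp: block_bound_le_1)

lemma fib_Suc_gt: "n < fib (Suc (Suc n))"
proof (induction n rule: fib.induct)
  case (3 n)
  then show ?case using fib_neq_0_nat[of "Suc n"] by simp
qed auto

theorem theorem1p1:
  fixes \<phi> :: real
  assumes "\<phi> = (sqrt 5 - 1) / 2"
  shows "liminf (\<lambda>N::nat. ereal (\<Prod>r=1..N. \<bar>2 * sin (pi * real r * \<phi>)\<bar>)) > 0"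
proof -
  have phi: "\<phi> = gold"
    using assms by (simp add: gold_def)
  define c where "c = (\<Prod>j<8. block_bound j)"
  have "c > 0"
    unfolding c_def using block_bound_pos by (intro prod_pos) auto
  have "ereal c \<le> ereal (\<Prod>r=1..N. \<bar>2 * sin (pi * real r * \<phi>)\<bar>)" for N
  proof -
    \<comment> \<open>With \<open>n \<ge> 8\<close> the product of the bounds collapses to
      \<open>c\<close>, since they are 1 from index 8 on. The unshifted product is the case
      \<open>s = 0\<close>.\<close>
    define n where "n = max 8 (Suc N)"
    have "N < fib (Suc (Suc N))" by (rule fib_Suc_gt)
    also have "\<dots> \<le> fib (Suc n)"
      by (rule fib_mono) (simp add: n_def)
    finally have "(\<Prod>j<n. block_bound j) \<le> sine_prod N gold ((-gold) ^ n * 0)"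
      using gold_bounds by (intro sine_prod_gold_lower) auto
    also have "(\<Prod>j<n. block_bound j) = c"
      unfolding c_def by (rule prod.mono_neutral_right) (auto simp: n_def block_bound_eq_1)
    finally show ?thesis
      by (simp add: sine_prod_def phi mult.assoc)
  qed
  then have "ereal c \<le> liminf (\<lambda>N::nat. ereal (\<Prod>r=1..N. \<bar>2 * sin (pi * real r * \<phi>)\<bar>))"
    by (intro Liminf_bounded) simp
  then show ?thesis
    using \<open>c > 0\<close> by (metis ereal_less(2) less_le_trans)
qed

end
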